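(* For each integer $N\ge1$ let $X_1^{(N)},X_2^{(N)},\dots$ be independent, identically distributed random real $N\times N$ matrices which satisfy: (A) each $X_i^{(N)}$ is rotationally invariant; (B) for all $N$, $E\log^+\|X_i^{(N)}\|$ exists (is finite); (D$'$) $E\big[\log\|X_i^{(N)}u\|\big]^2$ exists and is bounded by a constant that does not depend on $N$, where $u\in\mathbb R^N$ is an arbitrary unit vector. Let $\Pi_n=X_n^{(N)}\cdots X_1^{(N)}$ and let $v\in\mathbb R^N$ be an arbitrary unit vector. Suppose that for every $\delta>0$ there exists $n_0(\delta)$ such that $$\Pr\left\{\left|n^{-1}\log\|\Pi_n\|-E\log\|X_1^{(N)}v\|\right|\ge\delta\right\}\le\delta$$ for all $N\ge 1$ and all $n\ge n_0(\delta)$. Let $b(N)$ be an arbitrary function of $N$ such that $\lim_{N\to\infty}b(N)=+\infty$. Then $$\lim_{N\to\infty}\Pr\left\{\|X_1^{(N)}\|\ge b(N)\right\}=0.$$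
   Context: $\|\cdot\|$ is the Euclidean norm of vectors and the operator norm of matrices; $\log^+x=\max(\log x,0)$. A random $N\times N$ matrix $X$ is called rotationally invariant if for every integer $k\ge1$, every collection of vectors $\{v_i,w_i\}_{i=1}^k$ and every orthogonal matrix $U$, the joint distributions of $\{\langle w_i,Xv_i\rangle\}_{i=1}^k$ and $\{\langle Uw_i,XUv_i\rangle\}_{i=1}^k$ are the same. (Consequently the distribution of $\|X_i^{(N)}u\|$ is the same for all unit vectors $u$.) In (D$'$), $E[\log\|X_i^{(N)}u\|]^2$ denotes the second moment $E\big[(\log\|X_i^{(N)}u\|)^2\big]$. *)

theory Defs
  imports "HOL-Probability.Probability" "Jordan_Normal_Form.Matrix"
begin

text \<open>
  The dimension \<open>N\<close> varies inside the statement, so vectors and matrices are those of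
  \<open>Jordan_Normal_Form\<close>, whose size is part of the value. From here on \<open>\<bullet>\<close> is
  \<^const>\<open>scalar_prod\<close>.
\<close>

unbundle no inner_syntax

definition vnorm :: "real vec \<Rightarrow> real" where
  "vnorm v = sqrt (v \<bullet> v)"

definition mat_opnorm :: "real mat \<Rightarrow> real" where
  "mat_opnorm A = Sup {vnorm (A *\<^sub>v v) | v. v \<in> carrier_vec (dim_col A) \<and> vnorm v \<le> 1}"

text \<open>
  The totalised \<^prop>\<open>ln 0 = (0::real)\<close> gives the correct value at \<open>0\<close> here. Elsewhere \<^const>\<open>ln\<close>
  is only applied to quantities that the hypotheses make almost surely positive.
\<close>

definition log_plus :: "real \<Rightarrow> real" where
  "log_plus x = max (ln x) 0"

definition unit_sphere :: "nat \<Rightarrow> real vec set" where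
  "unit_sphere N = {v \<in> carrier_vec N. vnorm v = 1}"

text \<open>
  The library's \<^const>\<open>orthogonal_mat\<close> only asks for pairwise orthogonal columns, not for
  orthonormal ones.
\<close>

definition orthogonal_mats :: "nat \<Rightarrow> real mat set" where
  "orthogonal_mats N = {U \<in> carrier_mat N N. transpose_mat U * U = 1\<^sub>m N}"

text \<open>The Borel sets of the \<open>N \<times> N\<close> matrices, identified with the product of \<open>N * N\<close> real lines.\<close>

definition mat_borel :: "nat \<Rightarrow> real mat measure" where
  "mat_borel N = vimage_algebra (carrier_mat N N)
     (\<lambda>A. \<lambda>ij\<in>{..<N} \<times> {..<N}. A $$ ij)
     (Pi\<^sub>M ({..<N} \<times> {..<N}) (\<lambda>_. borel))"

lemma measurable_mat_borel_iff:
  "X \<in> measurable M (mat_borel N) \<longleftrightarrow>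
     (\<forall>\<omega>\<in>space M. X \<omega> \<in> carrier_mat N N) \<and>
     (\<forall>i<N. \<forall>j<N. (\<lambda>\<omega>. X \<omega> $$ (i, j)) \<in> borel_measurable M)"
  (is "?L \<longleftrightarrow> ?R")
proof
  let ?I = "{..<N} \<times> {..<N}"
  let ?f = "\<lambda>A::real mat. \<lambda>ij\<in>?I. A $$ ij"
  let ?P = "Pi\<^sub>M ?I (\<lambda>_. borel :: real measure)"
  have f: "?f \<in> carrier_mat N N \<rightarrow> space ?P"
    by (auto simp: space_PiM)
  {
    assume X: ?L
    have "?f \<in> measurable (mat_borel N) ?P"
      unfolding mat_borel_def by (rule measurable_vimage_algebra1[OF f])
    from measurable_compose[OF X this] have fX: "(\<lambda>\<omega>. ?f (X \<omega>)) \<in> measurable M ?P" .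
    have "(\<lambda>\<omega>. X \<omega> $$ (i, j)) \<in> borel_measurable M" if "i < N" "j < N" for i j
      using measurable_compose[OF fX measurable_component_singleton[of "(i, j)"]] that by simp
    moreover have "X \<omega> \<in> carrier_mat N N" if "\<omega> \<in> space M" for \<omega>
      using measurable_space[OF X that] by (simp add: mat_borel_def)
    ultimately show ?R by blast
  next
    assume R: ?R
    have "(\<lambda>\<omega>. ?f (X \<omega>)) \<in> measurable M ?P"
      by (rule measurable_restrict) (use R in auto)
    then show ?L
      unfolding mat_borel_def using R
      by (intro measurable_vimage_algebra2) auto
  }
qed

definition rotationally_invariant :: "'a measure \<Rightarrow> nat \<Rightarrow> ('a \<Rightarrow> real mat) \<Rightarrow> bool" where
  "rotationally_invariant M N X \<longleftrightarrow>
     (\<forall>k\<ge>1::nat. \<forall>v w. \<forall>U\<in>orthogonal_mats N.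
        v \<in> {1..k} \<rightarrow> carrier_vec N \<longrightarrow> w \<in> {1..k} \<rightarrow> carrier_vec N \<longrightarrow>
        distr M (Pi\<^sub>M {1..k} (\<lambda>_. borel))
          (\<lambda>\<omega>. \<lambda>i\<in>{1..k}. w i \<bullet> (X \<omega> *\<^sub>v v i)) =
        distr M (Pi\<^sub>M {1..k} (\<lambda>_. borel))
          (\<lambda>\<omega>. \<lambda>i\<in>{1..k}. (U *\<^sub>v w i) \<bullet> (X \<omega> *\<^sub>v (U *\<^sub>v v i))))"

primrec mat_prod :: "nat \<Rightarrow> (nat \<Rightarrow> 'a \<Rightarrow> real mat) \<Rightarrow> nat \<Rightarrow> 'a \<Rightarrow> real mat" where
  "mat_prod N X 0 \<omega> = 1\<^sub>m N"
| "mat_prod N X (Suc n) \<omega> = X (Suc n) \<omega> * mat_prod N X n \<omega>"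

end

theory Submission
  imports Defs
begin

text \<open>
  If \<open>B\<close> is independent of \<open>A\<close>, then \<open>\<parallel>A\<parallel> > c\<close> forces \<open>\<parallel>B A\<parallel> > s c\<close> outside an event whose
  probability is at most \<open>sup\<^sub>u \<P>(\<parallel>B u\<parallel> \<le> s)\<close>: condition on \<open>A\<close> and choose a vector \<open>v\<close> of the unit ball
  with \<open>\<parallel>A v\<parallel> > c\<close>. Iterating, a large \<open>\<parallel>X\<^sub>1\<parallel>\<close> makes \<open>\<parallel>\<Pi>\<^sub>n\<parallel>\<close> large, up to \<open>n - 1\<close> such events. By (D')
  and Chebyshev's inequality their probability is small uniformly in \<open>N\<close> once \<open>s\<close> is small, while for a
  fixed \<open>n\<close> the norm \<open>\<parallel>\<Pi>\<^sub>n\<parallel>\<close> is tight in \<open>N\<close> by the uniform convergence hypothesis.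
\<close>

unbundle no vec_syntax

section \<open>Euclidean norm and operator norm\<close>

lemma vnorm_vec: "vnorm (vec N f) = sqrt (\<Sum>i<N. (f i)\<^sup>2)"
  by (simp add: vnorm_def scalar_prod_def power2_eq_square atLeast0LessThan)

lemma vnorm_nonneg: "0 \<le> vnorm v"
  by (simp add: vnorm_def scalar_prod_def sum_nonneg)

lemma vnorm_eq: "v \<in> carrier_vec N \<Longrightarrow> vnorm v = sqrt (\<Sum>i<N. (v $ i)\<^sup>2)"
  by (auto simp: vnorm_def scalar_prod_def power2_eq_square atLeast0LessThan)

lemma vnorm_smult: "vnorm (a \<cdot>\<^sub>v v) = \<bar>a\<bar> * vnorm v"
proof -
  have v: "v \<in> carrier_vec (dim_vec v)"
    by (rule carrier_vec_dim_vec)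
  have "vnorm (a \<cdot>\<^sub>v v) = sqrt (\<Sum>i<dim_vec v. (a * v $ i)\<^sup>2)"
    unfolding vnorm_eq[OF smult_carrier_vec[THEN iffD2, OF v]] by simp
  also have "\<dots> = \<bar>a\<bar> * sqrt (\<Sum>i<dim_vec v. (v $ i)\<^sup>2)"
    by (simp only: power_mult_distrib sum_distrib_left[symmetric] real_sqrt_mult real_sqrt_abs)
  finally show ?thesis
    unfolding vnorm_eq[OF v] .
qed

lemma mult_mat_vec_eq_vec:
  assumes "A \<in> carrier_mat m N" "v \<in> carrier_vec N"
  shows "A *\<^sub>v v = vec m (\<lambda>i. \<Sum>j<N. A $$ (i, j) * v $ j)"
  using assms by (intro eq_vecI) (auto simp: scalar_prod_def atLeast0LessThan)

lemma abs_index_le_vnorm: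
  assumes "v \<in> carrier_vec N" "i < N"
  shows "\<bar>v $ i\<bar> \<le> vnorm v"
proof -
  have "(v $ i)\<^sup>2 \<le> (\<Sum>i<N. (v $ i)\<^sup>2)"
    using assms by (intro member_le_sum) auto
  then have "sqrt ((v $ i)\<^sup>2) \<le> sqrt (\<Sum>i<N. (v $ i)\<^sup>2)"
    by (rule real_sqrt_le_mono)
  then show ?thesis
    using vnorm_eq[OF assms(1)] by simp
qed

text \<open>Coordinates of a vector in the unit ball are at most 1 in absolute value, so each
  coordinate of \<open>A *\<^sub>v v\<close> is bounded by an absolute row sum of \<open>A\<close>.
  Without this bound the \<open>Sup\<close> in \<open>mat_opnorm\<close> would carry no
  information.\<close>

lemma bdd_above_mat_opnorm:
  "bdd_above {vnorm (A *\<^sub>v v) | v. v \<in> carrier_vec (dim_col A) \<and> vnorm v \<le> 1}"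
proof (rule bdd_aboveI)
  let ?K = "sqrt (\<Sum>i<dim_row A. (\<Sum>j<dim_col A. \<bar>A $$ (i, j)\<bar>)\<^sup>2)"
  fix x
  assume "x \<in> {vnorm (A *\<^sub>v v) | v. v \<in> carrier_vec (dim_col A) \<and> vnorm v \<le> 1}"
  then obtain v where v: "v \<in> carrier_vec (dim_col A)" "vnorm v \<le> 1" and x: "x = vnorm (A *\<^sub>v v)"
    by auto
  have "\<bar>\<Sum>j<dim_col A. A $$ (i, j) * v $ j\<bar> \<le> (\<Sum>j<dim_col A. \<bar>A $$ (i, j)\<bar>)" for i
  proof (rule order_trans[OF sum_abs], rule sum_mono)
    fix j
    assume "j \<in> {..<dim_col A}"
    then have "\<bar>v $ j\<bar> \<le> 1"
      using abs_index_le_vnorm[OF v(1), of j] v(2) by simp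
    then show "\<bar>A $$ (i, j) * v $ j\<bar> \<le> \<bar>A $$ (i, j)\<bar>"
      by (simp add: abs_mult mult_left_le)
  qed
  then have "(\<Sum>j<dim_col A. A $$ (i, j) * v $ j)\<^sup>2 \<le> (\<Sum>j<dim_col A. \<bar>A $$ (i, j)\<bar>)\<^sup>2" for i
    by (metis abs_ge_zero power2_abs power_mono)
  then show "x \<le> ?K"
    unfolding x mult_mat_vec_eq_vec[OF carrier_matI[OF refl refl] v(1)] vnorm_vec
    by (intro real_sqrt_le_mono sum_mono)
qed

lemma vnorm_mult_le_mat_opnorm:
  assumes "A \<in> carrier_mat m N" "v \<in> carrier_vec N" "vnorm v \<le> 1"
  shows "vnorm (A *\<^sub>v v) \<le> mat_opnorm A"
  unfolding mat_opnorm_def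
  by (rule cSup_upper[OF _ bdd_above_mat_opnorm]) (use assms in auto)

lemma zero_in_unit_ball: "0\<^sub>v N \<in> carrier_vec N" "vnorm (0\<^sub>v N) \<le> 1"
  by (auto simp: vnorm_def)

lemma mat_opnorm_nonneg: "0 \<le> mat_opnorm A"
  using vnorm_mult_le_mat_opnorm[OF carrier_matI[OF refl refl] zero_in_unit_ball]
  by (rule order_trans[OF vnorm_nonneg])

lemma mat_opnorm_leI:
  assumes "A \<in> carrier_mat m N"
    and "\<And>v. v \<in> carrier_vec N \<Longrightarrow> vnorm v \<le> 1 \<Longrightarrow> vnorm (A *\<^sub>v v) \<le> c"
  shows "mat_opnorm A \<le> c"
  unfolding mat_opnorm_def
proof (rule cSup_least)
  show "{vnorm (A *\<^sub>v v) | v. v \<in> carrier_vec (dim_col A) \<and> vnorm v \<le> 1} \<noteq> {}"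
    using zero_in_unit_ball by blast
qed (use assms in auto)

lemma normalise_in_unit_sphere:
  assumes "y \<in> carrier_vec N" "vnorm y > 0"
  shows "(1 / vnorm y) \<cdot>\<^sub>v y \<in> unit_sphere N"
  using assms by (simp add: unit_sphere_def vnorm_smult)

text \<open>Homogeneity reduces to the unit sphere. A vector of norm 0 cannot be normalised, but all
  its coordinates vanish, so both sides are 0.\<close>

lemma vnorm_mult_le_mat_opnorm_mult:
  assumes A: "A \<in> carrier_mat m N" and v: "v \<in> carrier_vec N"
  shows "vnorm (A *\<^sub>v v) \<le> mat_opnorm A * vnorm v"
proof (cases "vnorm v = 0")
  case True
  then have "v $ j = 0" if "j < N" for j
    using abs_index_le_vnorm[OF v that] by simp
  then have "vnorm (A *\<^sub>v v) = 0"
    unfolding mult_mat_vec_eq_vec[OF A v] vnorm_vec by simp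
  then show ?thesis
    using True by simp
next
  case False
  then have pos: "vnorm v > 0"
    using vnorm_nonneg[of v] by simp
  have "vnorm (A *\<^sub>v ((1 / vnorm v) \<cdot>\<^sub>v v)) \<le> mat_opnorm A"
    using normalise_in_unit_sphere[OF v pos]
    by (intro vnorm_mult_le_mat_opnorm[OF A]) (auto simp: unit_sphere_def)
  then show ?thesis
    using pos by (simp add: mult_mat_vec[OF A v] vnorm_smult field_simps)
qed

text \<open>Testing on rational vectors exhibits the operator norm as a countable supremum, hence measurable.\<close>

lemma mat_opnorm_le_iff_rat:
  assumes A: "A \<in> carrier_mat m N" and c: "0 \<le> c"
  shows "mat_opnorm A \<le> c \<longleftrightarrow>
    (\<forall>r::rat list. vnorm (A *\<^sub>v vec N (\<lambda>j. of_rat (r ! j))) \<le> c * vnorm (vec N (\<lambda>j. of_rat (r ! j))))"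
    (is "_ \<longleftrightarrow> (\<forall>r. ?P r)")
proof
  assume le: "mat_opnorm A \<le> c"
  show "\<forall>r. ?P r"
  proof
    fix r :: "rat list"
    show "?P r"
      by (rule order_trans[OF vnorm_mult_le_mat_opnorm_mult[OF A]])
        (auto intro: mult_right_mono[OF le] vnorm_nonneg)
  qed
next
  assume rat: "\<forall>r. ?P r"
  show "mat_opnorm A \<le> c"
  proof (rule mat_opnorm_leI[OF A])
    fix v
    assume v: "v \<in> carrier_vec N" "vnorm v \<le> 1"
    \<comment> \<open>Coordinatewise approximation from above may leave the unit ball. This is why
      the criterion compares with \<open>c\<close> times the norm of the test vector and not with
      \<open>c\<close> alone.\<close>
    have "\<exists>q::rat. v $ j < of_rat q \<and> of_rat q < v $ j + inverse (real (Suc k))" for j k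
      by (rule of_rat_dense) simp
    then obtain q :: "nat \<Rightarrow> nat \<Rightarrow> rat"
      where q: "\<And>j k. v $ j < of_rat (q j k)" "\<And>j k. of_rat (q j k) < v $ j + inverse (real (Suc k))"
      by metis
    have lim: "(\<lambda>k. of_rat (q j k) :: real) \<longlonglongrightarrow> v $ j" for j
    proof (rule tendsto_sandwich[OF _ _ tendsto_const])
      show "(\<lambda>k. v $ j + inverse (real (Suc k))) \<longlonglongrightarrow> v $ j"
        by (rule LIMSEQ_inverse_real_of_nat_add)
    qed (intro always_eventually allI less_imp_le q)+
    define w :: "nat \<Rightarrow> real vec" where "w k = vec N (\<lambda>j. of_rat (q j k))" for k
    have w: "w k \<in> carrier_vec N" for k
      by (simp add: w_def)
    \<comment> \<open>The type \<open>rat list\<close> is countable, and every rational vector of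
      dimension \<open>N\<close> comes from a list of length \<open>N\<close>.\<close>
    have "w k = vec N (\<lambda>j. of_rat (map (\<lambda>j. q j k) [0..<N] ! j))" for k
      by (auto simp: w_def)
    then have le: "vnorm (A *\<^sub>v w k) \<le> c * vnorm (w k)" for k
      using rat by metis
    have "(\<lambda>k. vnorm (w k)) \<longlonglongrightarrow> vnorm v"
      unfolding vnorm_eq[OF v(1)] unfolding w_def vnorm_vec by (intro tendsto_intros lim)
    moreover have "(\<lambda>k. vnorm (A *\<^sub>v w k)) \<longlonglongrightarrow> vnorm (A *\<^sub>v v)"
    proof -
      have "vnorm (A *\<^sub>v w k) = sqrt (\<Sum>i<m. (\<Sum>j<N. A $$ (i, j) * of_rat (q j k))\<^sup>2)" for k
        unfolding mult_mat_vec_eq_vec[OF A w] vnorm_vec by (simp add: w_def)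
      then show ?thesis
        unfolding mult_mat_vec_eq_vec[OF A v(1)] vnorm_vec
        by (auto intro!: tendsto_intros lim)
    qed
    ultimately have "vnorm (A *\<^sub>v v) \<le> c * vnorm v"
      using le by (intro LIMSEQ_le[OF _ tendsto_mult_left]) auto
    also have "\<dots> \<le> c"
      using v(2) c by (simp add: mult_left_le)
    finally show "vnorm (A *\<^sub>v v) \<le> c" .
  qed
qed

section \<open>Measurability of norms and products of random matrices\<close>

lemma space_mat_borel: "space (mat_borel N) = carrier_mat N N"
  by (simp add: mat_borel_def)

lemma measurable_mat_borel_carrier:
  "X \<in> measurable M (mat_borel N) \<Longrightarrow> \<omega> \<in> space M \<Longrightarrow> X \<omega> \<in> carrier_mat N N"
  by (simp add: measurable_mat_borel_iff)

lemma measurable_mat_entry: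
  "X \<in> measurable M (mat_borel N) \<Longrightarrow> i < N \<Longrightarrow> j < N \<Longrightarrow> (\<lambda>\<omega>. X \<omega> $$ (i, j)) \<in> borel_measurable M"
  by (simp add: measurable_mat_borel_iff)

lemma measurable_vnorm_mult:
  assumes X: "X \<in> measurable M (mat_borel N)" and v: "v \<in> carrier_vec N"
  shows "(\<lambda>\<omega>. vnorm (X \<omega> *\<^sub>v v)) \<in> borel_measurable M"
proof -
  have "(\<lambda>\<omega>. sqrt (\<Sum>i<N. (\<Sum>j<N. X \<omega> $$ (i, j) * v $ j)\<^sup>2)) \<in> borel_measurable M"
    by (intro measurable_compose[OF _ borel_measurable_sqrt] borel_measurable_sum borel_measurable_power
        borel_measurable_times measurable_const measurable_mat_entry[OF X]) auto
  also have "?this \<longleftrightarrow> ?thesis"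
    by (intro measurable_cong)
      (simp add: mult_mat_vec_eq_vec[OF measurable_mat_borel_carrier[OF X] v] vnorm_vec)
  finally show ?thesis .
qed

lemma measurable_mat_opnorm:
  assumes X: "X \<in> measurable M (mat_borel N)"
  shows "(\<lambda>\<omega>. mat_opnorm (X \<omega>)) \<in> borel_measurable M"
  unfolding borel_measurable_iff_le
proof
  fix c
  show "{\<omega> \<in> space M. mat_opnorm (X \<omega>) \<le> c} \<in> sets M"
  proof (cases "0 \<le> c")
    case True
    let ?w = "\<lambda>r::rat list. vec N (\<lambda>j. of_rat (r ! j)) :: real vec"
    have "{\<omega> \<in> space M. mat_opnorm (X \<omega>) \<le> c} =
        {\<omega> \<in> space M. \<forall>r. vnorm (X \<omega> *\<^sub>v ?w r) \<le> c * vnorm (?w r)}"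
      using mat_opnorm_le_iff_rat[OF measurable_mat_borel_carrier[OF X] True] by auto
    also have "\<dots> \<in> sets M"
      by (intro sets.sets_Collect_countable_All borel_measurable_le measurable_vnorm_mult[OF X]) auto
    finally show ?thesis .
  next
    \<comment> \<open>The rational criterion needs \<open>0 \<le> c\<close>; below 0 the sublevel
      set is empty.\<close>
    case False
    then have "\<not> mat_opnorm (X \<omega>) \<le> c" for \<omega>
      using mat_opnorm_nonneg[of "X \<omega>"] by linarith
    then show ?thesis
      by simp
  qed
qed

lemma measurable_mat_mult:
  assumes X: "X \<in> measurable M (mat_borel N)" and Y: "Y \<in> measurable M (mat_borel N)"
  shows "(\<lambda>\<omega>. X \<omega> * Y \<omega>) \<in> measurable M (mat_borel N)"
  unfolding measurable_mat_borel_iff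
proof (intro conjI ballI allI impI)
  fix \<omega>
  assume "\<omega> \<in> space M"
  then show "X \<omega> * Y \<omega> \<in> carrier_mat N N"
    by (intro mult_carrier_mat[of _ N N] measurable_mat_borel_carrier[OF X] measurable_mat_borel_carrier[OF Y])
next
  fix i j
  assume ij: "i < N" "j < N"
  have "(\<lambda>\<omega>. \<Sum>k<N. X \<omega> $$ (i, k) * Y \<omega> $$ (k, j)) \<in> borel_measurable M"
    using ij
    by (intro borel_measurable_sum borel_measurable_times measurable_mat_entry[OF X]
        measurable_mat_entry[OF Y]) auto
  also have "?this \<longleftrightarrow> (\<lambda>\<omega>. (X \<omega> * Y \<omega>) $$ (i, j)) \<in> borel_measurable M"
  proof (intro measurable_cong)
    fix \<omega>
    assume "\<omega> \<in> space M"
    then have "X \<omega> \<in> carrier_mat N N" "Y \<omega> \<in> carrier_mat N N"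
      using measurable_mat_borel_carrier[OF X] measurable_mat_borel_carrier[OF Y] by auto
    then show "(\<Sum>k<N. X \<omega> $$ (i, k) * Y \<omega> $$ (k, j)) = (X \<omega> * Y \<omega>) $$ (i, j)"
      using ij by (auto simp: scalar_prod_def atLeast0LessThan)
  qed
  finally show "(\<lambda>\<omega>. (X \<omega> * Y \<omega>) $$ (i, j)) \<in> borel_measurable M" .
qed

lemma measurable_mat_prod:
  assumes "\<And>i. i \<in> {1..n} \<Longrightarrow> X i \<in> measurable M (mat_borel N)"
  shows "mat_prod N X n \<in> measurable M (mat_borel N)"
  using assms
proof (induction n)
  case 0
  then show ?case
    by (simp add: measurable_mat_borel_iff)
next
  case (Suc n)
  have "(\<lambda>\<omega>. X (Suc n) \<omega> * mat_prod N X n \<omega>) \<in> measurable M (mat_borel N)"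
    by (intro measurable_mat_mult Suc) (use Suc.prems in auto)
  also have "(\<lambda>\<omega>. X (Suc n) \<omega> * mat_prod N X n \<omega>) = mat_prod N X (Suc n)"
    by auto
  finally show ?case .
qed

section \<open>Independence and growth of the operator norm along the product\<close>

text \<open>Exhibits the product as a function of a tuple of factors, as independence of blocks
  requires. The tuple length \<open>m\<close> stays fixed while \<open>n\<close> runs, which lets
  the induction go through.\<close>

lemma mat_prod_restrict:
  "n \<le> m \<Longrightarrow> mat_prod N (\<lambda>i x. x i) n (\<lambda>i\<in>{1..m}. X i \<omega>) = mat_prod N X n \<omega>"
  by (induction n) auto

lemma (in prob_space) indep_vars_measurable:
  "indep_vars M' X I \<Longrightarrow> i \<in> I \<Longrightarrow> X i \<in> measurable M (M' i)"
  unfolding indep_vars_def by blast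

text \<open>The two matrices are measurable functions of the disjoint index blocks
  \<open>{1..n}\<close> and \<open>{Suc n}\<close>.\<close>

lemma (in prob_space) indep_var_mat_prod_Suc:
  assumes ind: "indep_vars (\<lambda>_. mat_borel N) X {1..}"
  shows "indep_var (mat_borel N) (mat_prod N X n) (mat_borel N) (X (Suc n))"
proof -
  have "indep_var (Pi\<^sub>M {1..n} (\<lambda>_. mat_borel N)) (\<lambda>\<omega>. \<lambda>i\<in>{1..n}. X i \<omega>)
      (Pi\<^sub>M {Suc n} (\<lambda>_. mat_borel N)) (\<lambda>\<omega>. \<lambda>i\<in>{Suc n}. X i \<omega>)"
    by (rule indep_var_restrict[OF ind]) auto
  from indep_var_compose[OF this measurable_mat_prod measurable_component_singleton,
      of n "\<lambda>i x. x i" N "Suc n"]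
  have "indep_var (mat_borel N) (mat_prod N (\<lambda>i x. x i) n \<circ> (\<lambda>\<omega>. \<lambda>i\<in>{1..n}. X i \<omega>))
      (mat_borel N) ((\<lambda>x. x (Suc n)) \<circ> (\<lambda>\<omega>. \<lambda>i\<in>{Suc n}. X i \<omega>))"
    by simp
  moreover have "mat_prod N (\<lambda>i x. x i) n \<circ> (\<lambda>\<omega>. \<lambda>i\<in>{1..n}. X i \<omega>) = mat_prod N X n"
    using mat_prod_restrict[OF order_refl, of N n X] by (auto simp only: comp_def)
  moreover have "(\<lambda>x. x (Suc n)) \<circ> (\<lambda>\<omega>. \<lambda>i\<in>{Suc n}. X i \<omega>) = X (Suc n)"
    by auto
  ultimately show ?thesis
    by (simp only:)
qed

text \<open>Conditioning on \<open>A\<close> is Fubini for the joint law, a product measure by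
  independence. Once \<open>A\<close> is frozen at \<open>a\<close>, the critical direction depends
  on \<open>a\<close> only, so a bound for \<open>B\<close> on fixed unit vectors suffices. The
  fibres are bounded one at a time, so the direction need not be chosen measurably in
  \<open>a\<close>.\<close>

lemma (in prob_space) prob_opnorm_mult_le:
  assumes ind: "indep_var (mat_borel N) A (mat_borel N) B"
    and p: "\<And>u. u \<in> unit_sphere N \<Longrightarrow> \<P>(\<omega> in M. vnorm (B \<omega> *\<^sub>v u) \<le> s) \<le> p"
    and p0: "0 \<le> p" and s: "0 < s" and c: "0 \<le> c"
  shows "\<P>(\<omega> in M. mat_opnorm (B \<omega> * A \<omega>) \<le> s * c) \<le> \<P>(\<omega> in M. mat_opnorm (A \<omega>) \<le> c) + p"
proof -
  let ?S = "mat_borel N"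
  let ?\<mu> = "distr M ?S A" and ?\<nu> = "distr M ?S B"
  have A[measurable]: "A \<in> measurable M ?S" and B[measurable]: "B \<in> measurable M ?S"
    and joint: "?\<mu> \<Otimes>\<^sub>M ?\<nu> = distr M (?S \<Otimes>\<^sub>M ?S) (\<lambda>\<omega>. (A \<omega>, B \<omega>))"
    using ind unfolding indep_var_distribution_eq by auto
  interpret \<nu>: prob_space ?\<nu>
    by (rule prob_space_distr[OF B])
  interpret \<mu>: prob_space ?\<mu>
    by (rule prob_space_distr[OF A])
  have [measurable]: "(\<lambda>x. mat_opnorm (fst x)) \<in> borel_measurable (?S \<Otimes>\<^sub>M ?S)"
    "(\<lambda>x. mat_opnorm (snd x * fst x)) \<in> borel_measurable (?S \<Otimes>\<^sub>M ?S)"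
    by (auto intro!: measurable_mat_opnorm measurable_mat_mult)
  have [measurable]: "(\<lambda>\<omega>. mat_opnorm (A \<omega>)) \<in> borel_measurable M"
    "(\<lambda>\<omega>. mat_opnorm (B \<omega> * A \<omega>)) \<in> borel_measurable M"
    by (rule measurable_mat_opnorm[OF A] measurable_mat_opnorm[OF measurable_mat_mult[OF B A]])+
  \<comment> \<open>The bad event for the pair: the first matrix is large, yet multiplication by the
    second one brings the norm down to \<open>s * c\<close>.\<close>
  define E where "E = {x \<in> space (?S \<Otimes>\<^sub>M ?S). c < mat_opnorm (fst x) \<and> mat_opnorm (snd x * fst x) \<le> s * c}"
  have E[measurable]: "E \<in> sets (?S \<Otimes>\<^sub>M ?S)"
    unfolding E_def by measurable
  have fibre: "emeasure ?\<nu> (Pair a -` E) \<le> ennreal p" if a: "a \<in> space ?S" for a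
  proof (cases "c < mat_opnorm a")
    case False
    then have "Pair a -` E = {}"
      by (auto simp: E_def)
    then show ?thesis
      by simp
  next
    case True
    have aN: "a \<in> carrier_mat N N"
      using a by (simp add: space_mat_borel)
    \<comment> \<open>The supremum exceeds \<open>c\<close> strictly, so some vector of the ball
      does too, whether or not the supremum is attained. As \<open>0 \<le> c\<close>, its image is
      nonzero and can be normalised.\<close>
    obtain v where v: "v \<in> carrier_vec N" "vnorm v \<le> 1" "c < vnorm (a *\<^sub>v v)"
      using mat_opnorm_leI[OF aN, of c] True by (meson not_le)
    let ?y = "a *\<^sub>v v"
    have y: "?y \<in> carrier_vec N" "vnorm ?y > 0"
      using aN v c by auto
    let ?u = "(1 / vnorm ?y) \<cdot>\<^sub>v ?y"
    have u: "?u \<in> unit_sphere N"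
      by (rule normalise_in_unit_sphere[OF y])
    have uN: "?u \<in> carrier_vec N"
      using y by simp
    let ?F = "{b \<in> space ?S. vnorm (b *\<^sub>v ?u) \<le> s}"
    have [measurable]: "(\<lambda>b. vnorm (b *\<^sub>v ?u)) \<in> borel_measurable ?S"
      by (rule measurable_vnorm_mult[OF _ uN]) simp
    \<comment> \<open>On the fibre the norm of \<open>b *\<^sub>v ?y\<close> is at most
      \<open>s * c\<close>, hence at most \<open>s * vnorm ?y\<close>; dividing by
      \<open>vnorm ?y\<close> gives the bound at \<open>?u\<close>.\<close>
    have "Pair a -` E \<subseteq> ?F"
    proof
      fix b
      assume "b \<in> Pair a -` E"
      then have b: "b \<in> carrier_mat N N" "mat_opnorm (b * a) \<le> s * c"
        by (auto simp: E_def space_pair_measure space_mat_borel)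
      have "vnorm (b *\<^sub>v ?y) = vnorm ((b * a) *\<^sub>v v)"
        using b(1) aN v(1) by (simp add: assoc_mult_mat_vec)
      also have "\<dots> \<le> mat_opnorm (b * a)"
        using b(1) aN v by (intro vnorm_mult_le_mat_opnorm[of _ N N]) auto
      also have "\<dots> \<le> s * vnorm ?y"
        using b(2) v(3) s by (smt (verit) mult_left_mono)
      finally show "b \<in> ?F"
        using y b(1) by (simp add: mult_mat_vec[OF b(1) y(1)] vnorm_smult space_mat_borel field_simps)
    qed
    then have "emeasure ?\<nu> (Pair a -` E) \<le> emeasure ?\<nu> ?F"
      by (rule emeasure_mono) simp
    also have "\<dots> = ennreal (\<P>(\<omega> in M. vnorm (B \<omega> *\<^sub>v ?u) \<le> s))"
    proof -
      have "B -` ?F \<inter> space M = {\<omega> \<in> space M. vnorm (B \<omega> *\<^sub>v ?u) \<le> s}"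
        using measurable_space[OF B] by auto
      moreover have "?F \<in> sets ?S"
        by measurable
      ultimately show ?thesis
        by (simp only: emeasure_distr[OF B] emeasure_eq_measure)
    qed
    also have "\<dots> \<le> ennreal p"
      by (rule ennreal_leI[OF p[OF u]])
    finally show ?thesis .
  qed
  have "emeasure (?\<mu> \<Otimes>\<^sub>M ?\<nu>) E = (\<integral>\<^sup>+ a. emeasure ?\<nu> (Pair a -` E) \<partial>?\<mu>)"
    by (rule \<nu>.emeasure_pair_measure_alt) simp
  also have "\<dots> \<le> (\<integral>\<^sup>+ a. ennreal p \<partial>?\<mu>)"
    by (rule nn_integral_mono) (simp add: fibre)
  also have "\<dots> = ennreal p"
    using \<mu>.emeasure_space_1 by simp
  finally have "emeasure (distr M (?S \<Otimes>\<^sub>M ?S) (\<lambda>\<omega>. (A \<omega>, B \<omega>))) E \<le> ennreal p"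
    unfolding joint .
  then have "emeasure M ((\<lambda>\<omega>. (A \<omega>, B \<omega>)) -` E \<inter> space M) \<le> ennreal p"
    by (subst (asm) emeasure_distr) auto
  also have "(\<lambda>\<omega>. (A \<omega>, B \<omega>)) -` E \<inter> space M =
      {\<omega> \<in> space M. c < mat_opnorm (A \<omega>) \<and> mat_opnorm (B \<omega> * A \<omega>) \<le> s * c}" (is "_ = ?G")
    using measurable_space[OF A] measurable_space[OF B] by (auto simp: E_def space_pair_measure)
  finally have G: "prob ?G \<le> p"
    using p0 by (simp add: emeasure_eq_measure)
  \<comment> \<open>If the product is small, either \<open>A\<close> was already small or the bad
    event occurred.\<close>
  have "\<P>(\<omega> in M. mat_opnorm (B \<omega> * A \<omega>) \<le> s * c) \<le> prob ({\<omega> \<in> space M. mat_opnorm (A \<omega>) \<le> c} \<union> ?G)"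
    by (rule finite_measure_mono) auto
  also have "\<dots> \<le> \<P>(\<omega> in M. mat_opnorm (A \<omega>) \<le> c) + prob ?G"
    by (rule measure_Un_le) auto
  finally show ?thesis
    using G by simp
qed

text \<open>Each left multiplication after the first factor scales the threshold by \<open>s\<close>
  and costs probability \<open>p\<close>; \<open>Suc n\<close> factors contain \<open>n\<close> such
  multiplications.\<close>

lemma (in prob_space) prob_opnorm_mat_prod_le:
  assumes ind: "indep_vars (\<lambda>_. mat_borel N) X {1..}"
    and p: "\<And>i u. i \<ge> 1 \<Longrightarrow> u \<in> unit_sphere N \<Longrightarrow> \<P>(\<omega> in M. vnorm (X i \<omega> *\<^sub>v u) \<le> s) \<le> p"
    and p0: "0 \<le> p" and s: "0 < s" and c: "0 \<le> c"
  shows "\<P>(\<omega> in M. mat_opnorm (mat_prod N X (Suc n) \<omega>) \<le> s ^ n * c) \<le>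
    \<P>(\<omega> in M. mat_opnorm (X 1 \<omega>) \<le> c) + n * p"
proof (induction n)
  case 0
  have "X 1 \<in> measurable M (mat_borel N)"
    using ind by (rule indep_vars_measurable) simp
  from right_mult_one_mat[OF measurable_mat_borel_carrier[OF this]]
  have "mat_prod N X 1 \<omega> = X 1 \<omega>" if "\<omega> \<in> space M" for \<omega>
    using that by simp
  then have "{\<omega> \<in> space M. mat_opnorm (mat_prod N X 1 \<omega>) \<le> c} = {\<omega> \<in> space M. mat_opnorm (X 1 \<omega>) \<le> c}"
    by auto
  then show ?case
    by simp
next
  case (Suc n)
  have "\<P>(\<omega> in M. mat_opnorm (X (Suc (Suc n)) \<omega> * mat_prod N X (Suc n) \<omega>) \<le> s * (s ^ n * c)) \<le>
      \<P>(\<omega> in M. mat_opnorm (mat_prod N X (Suc n) \<omega>) \<le> s ^ n * c) + p"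
    using p0 s c
    by (intro prob_opnorm_mult_le[OF indep_var_mat_prod_Suc[OF ind]] p) auto
  also have "\<dots> \<le> \<P>(\<omega> in M. mat_opnorm (X 1 \<omega>) \<le> c) + n * p + p"
    using Suc.IH by (rule add_right_mono)
  also have "\<dots> = \<P>(\<omega> in M. mat_opnorm (X 1 \<omega>) \<le> c) + Suc n * p"
    by (simp add: distrib_right)
  finally show ?case
    unfolding mat_prod.simps(2)[of N X "Suc n"] power_Suc mult.assoc .
qed

section \<open>Consequences of a bounded second moment of the logarithm\<close>

text \<open>Markov's inequality for the squared logarithm. The almost sure condition
  \<open>Y \<omega> \<noteq> 0\<close> matters: since \<open>ln 0 = 0\<close>, an atom of
  \<open>Y\<close> at 0 would be invisible to the second moment.\<close>

lemma (in prob_space) prob_le_exp_minus: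
  fixes Y :: "'a \<Rightarrow> real"
  assumes Y: "Y \<in> borel_measurable M" "\<And>\<omega>. \<omega> \<in> space M \<Longrightarrow> 0 \<le> Y \<omega>" "AE \<omega> in M. Y \<omega> \<noteq> 0"
    and int: "integrable M (\<lambda>\<omega>. (ln (Y \<omega>))\<^sup>2)" "expectation (\<lambda>\<omega>. (ln (Y \<omega>))\<^sup>2) \<le> C"
    and L: "0 < L"
  shows "\<P>(\<omega> in M. Y \<omega> \<le> exp (- L)) \<le> C / L\<^sup>2"
proof -
  note Y(1)[measurable]
  have "\<P>(\<omega> in M. Y \<omega> \<le> exp (- L)) \<le> \<P>(\<omega> in M. L\<^sup>2 \<le> (ln (Y \<omega>))\<^sup>2)"
  proof (rule finite_measure_mono_AE)
    show "AE \<omega> in M. \<omega> \<in> {\<omega> \<in> space M. Y \<omega> \<le> exp (- L)} \<longrightarrow> \<omega> \<in> {\<omega> \<in> space M. L\<^sup>2 \<le> (ln (Y \<omega>))\<^sup>2}"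
      using Y(3)
    proof (rule AE_mp, intro AE_I2 impI)
      fix \<omega>
      assume "\<omega> \<in> space M" "Y \<omega> \<noteq> 0" "\<omega> \<in> {\<omega> \<in> space M. Y \<omega> \<le> exp (- L)}"
      then have "0 < Y \<omega>" "Y \<omega> \<le> exp (- L)"
        using Y(2)[of \<omega>] by auto
      then have "ln (Y \<omega>) \<le> - L"
        by (metis exp_gt_zero ln_exp ln_le_cancel_iff)
      then have "L\<^sup>2 \<le> (- ln (Y \<omega>))\<^sup>2"
        using L by (intro power_mono) auto
      then show "\<omega> \<in> {\<omega> \<in> space M. L\<^sup>2 \<le> (ln (Y \<omega>))\<^sup>2}"
        using \<open>\<omega> \<in> space M\<close> by simp
    qed
  qed simp
  also have "\<dots> \<le> expectation (\<lambda>\<omega>. (ln (Y \<omega>))\<^sup>2) / L\<^sup>2"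
    using L by (intro integral_Markov_inequality_measure[OF int(1), of "space M"]) auto
  also have "\<dots> \<le> C / L\<^sup>2"
    using int(2) by (intro divide_right_mono) auto
  finally show ?thesis .
qed

lemma (in prob_space) expectation_le_square_bound:
  fixes Y :: "'a \<Rightarrow> real"
  assumes "integrable M (\<lambda>\<omega>. (Y \<omega>)\<^sup>2)" "expectation (\<lambda>\<omega>. (Y \<omega>)\<^sup>2) \<le> C"
  shows "expectation Y \<le> 1 + C"
proof -
  \<comment> \<open>Only the majorant has to be integrable: the integral of a non-integrable
    \<open>Y\<close> is 0 by convention, and the majorant is nonnegative.\<close>
  have "expectation Y \<le> expectation (\<lambda>\<omega>. 1 + (Y \<omega>)\<^sup>2)"
  proof (rule Bochner_Integration.integral_mono')
    show "integrable M (\<lambda>\<omega>. 1 + (Y \<omega>)\<^sup>2)"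
      using assms(1) by auto
    show "Y \<omega> \<le> 1 + (Y \<omega>)\<^sup>2" for \<omega>
      using sum_squares_bound[of 1 "Y \<omega>"] zero_le_power2[of "Y \<omega>"]
      by (simp only: power_one mult_1_right)
  qed auto
  also have "\<dots> = 1 + expectation (\<lambda>\<omega>. (Y \<omega>)\<^sup>2)"
    using assms(1) by (simp add: prob_space)
  finally show ?thesis
    using assms(2) by simp
qed

section \<open>Tightness of the operator norm uniformly in the dimension\<close>

theorem theorem11:
  fixes M :: "nat \<Rightarrow> 'a measure"
    and X :: "nat \<Rightarrow> nat \<Rightarrow> 'a \<Rightarrow> real mat"
    and v :: "nat \<Rightarrow> real vec"
    and b :: "nat \<Rightarrow> real"
  assumes prob: "\<And>N. N \<ge> 1 \<Longrightarrow> prob_space (M N)"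
    and indep: "\<And>N. N \<ge> 1 \<Longrightarrow> prob_space.indep_vars (M N) (\<lambda>_. mat_borel N) (X N) {1..}"
    and ident: "\<And>N i. N \<ge> 1 \<Longrightarrow> i \<ge> 1 \<Longrightarrow>
      distr (M N) (mat_borel N) (X N i) = distr (M N) (mat_borel N) (X N 1)"
    and A: "\<And>N i. N \<ge> 1 \<Longrightarrow> i \<ge> 1 \<Longrightarrow> rotationally_invariant (M N) N (X N i)"
    and B: "\<And>N i. N \<ge> 1 \<Longrightarrow> i \<ge> 1 \<Longrightarrow>
      integrable (M N) (\<lambda>\<omega>. log_plus (mat_opnorm (X N i \<omega>)))"
    and D': "\<exists>C. \<forall>N\<ge>1. \<forall>i\<ge>1. \<forall>u\<in>unit_sphere N.
      (AE \<omega> in M N. vnorm (X N i \<omega> *\<^sub>v u) \<noteq> 0) \<and>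
      integrable (M N) (\<lambda>\<omega>. (ln (vnorm (X N i \<omega> *\<^sub>v u)))\<^sup>2) \<and>
      prob_space.expectation (M N) (\<lambda>\<omega>. (ln (vnorm (X N i \<omega> *\<^sub>v u)))\<^sup>2) \<le> C"
    and v: "\<And>N. N \<ge> 1 \<Longrightarrow> v N \<in> unit_sphere N"
    and conv: "\<forall>\<delta>>0. \<exists>n0. \<forall>N\<ge>1. \<forall>n\<ge>n0.
      \<P>(\<omega> in M N. \<bar>ln (mat_opnorm (mat_prod N (X N) n \<omega>)) / real n
         - prob_space.expectation (M N) (\<lambda>\<omega>. ln (vnorm (X N 1 \<omega> *\<^sub>v v N)))\<bar> \<ge> \<delta>) \<le> \<delta>"
    and b: "filterlim b at_top sequentially"
  shows "(\<lambda>N. \<P>(\<omega> in M N. mat_opnorm (X N 1 \<omega>) \<ge> b N)) \<longlonglongrightarrow> 0"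
proof -
  from D' obtain C where C: "\<And>N i u. N \<ge> 1 \<Longrightarrow> i \<ge> 1 \<Longrightarrow> u \<in> unit_sphere N \<Longrightarrow>
      (AE \<omega> in M N. vnorm (X N i \<omega> *\<^sub>v u) \<noteq> 0) \<and>
      integrable (M N) (\<lambda>\<omega>. (ln (vnorm (X N i \<omega> *\<^sub>v u)))\<^sup>2) \<and>
      prob_space.expectation (M N) (\<lambda>\<omega>. (ln (vnorm (X N i \<omega> *\<^sub>v u)))\<^sup>2) \<le> C"
    by blast
  \<comment> \<open>\<open>C\<close> bounds the mean of a square, so any one instance shows that it
    is nonnegative.\<close>
  have "0 \<le> prob_space.expectation (M 1) (\<lambda>\<omega>. (ln (vnorm (X 1 1 \<omega> *\<^sub>v v 1)))\<^sup>2)"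
    by (rule integral_nonneg_AE) simp
  then have C0: "0 \<le> C"
    using C[OF order_refl order_refl v[OF order_refl]] by linarith
  have small: "\<forall>\<^sub>F N in sequentially. \<P>(\<omega> in M N. mat_opnorm (X N 1 \<omega>) \<ge> b N) < \<epsilon>"
    if \<epsilon>: "0 < \<epsilon>" for \<epsilon>
  proof -
    \<comment> \<open>One \<open>\<delta>\<close> pays for the convergence hypothesis and one for
      the multiplications; a third of \<open>\<epsilon>\<close> keeps the final inequality
      strict.\<close>
    define \<delta> where "\<delta> = \<epsilon> / 3"
    have \<delta>: "0 < \<delta>"
      using \<epsilon> by (simp add: \<delta>_def)
    with conv obtain n0 where n0: "\<And>N n. N \<ge> 1 \<Longrightarrow> n \<ge> n0 \<Longrightarrow>
        \<P>(\<omega> in M N. \<bar>ln (mat_opnorm (mat_prod N (X N) n \<omega>)) / real n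
         - prob_space.expectation (M N) (\<lambda>\<omega>. ln (vnorm (X N 1 \<omega> *\<^sub>v v N)))\<bar> \<ge> \<delta>) \<le> \<delta>"
      by blast
    \<comment> \<open>With \<open>s = exp (- L)\<close>, each of the \<open>n0\<close>
      multiplications fails with probability at most \<open>C / L\<^sup>2\<close>. This
      \<open>L\<close> makes the total at most \<open>\<delta>\<close>; the summand 1 gives
      \<open>L \<le> L\<^sup>2\<close> and \<open>0 < L\<close>.\<close>
    define L where "L = 1 + n0 * C / \<delta>"
    have "0 \<le> n0 * C / \<delta>"
      using C0 \<delta> by simp
    then have L1: "1 \<le> L" and "n0 * C / \<delta> \<le> L"
      by (simp_all add: L_def)
    moreover have "L \<le> L\<^sup>2"
      using L1 by (simp add: power2_eq_square)
    ultimately have "n0 * C / \<delta> \<le> L\<^sup>2"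
      by linarith
    then have L: "n0 * (C / L\<^sup>2) \<le> \<delta>"
      using \<delta> L1 by (simp add: pos_divide_le_eq mult.commute)
    \<comment> \<open>The centring expectation is at most \<open>1 + C\<close>, so a norm above
      \<open>T\<close> for \<open>Suc n0\<close> factors is a deviation of at least
      \<open>\<delta>\<close>. Taking \<open>Suc n0\<close> keeps the divisor positive even if
      \<open>n0\<close> is 0.\<close>
    define T where "T = exp (Suc n0 * (1 + C + \<delta>))"
    \<comment> \<open>Chosen so that \<open>n0\<close> contractions by \<open>exp (- L)\<close>
      bring the threshold to exactly \<open>T\<close>. It does not depend on \<open>N\<close>, hence
      is eventually below \<open>b N\<close>.\<close>
    define c where "c = T / exp (- L) ^ n0"
    have c: "0 \<le> c" and Tc: "exp (- L) ^ n0 * c = T"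
      by (simp_all add: c_def T_def)
    have "\<forall>\<^sub>F N in sequentially. c < b N"
      using b by (simp add: filterlim_at_top_dense)
    then show ?thesis
      using eventually_ge_at_top[of 1]
    proof eventually_elim
      case (elim N)
      then have N: "N \<ge> 1"
        by simp
      interpret prob_space "M N"
        by (rule prob[OF N])
      have X: "X N i \<in> measurable (M N) (mat_borel N)" if "i \<ge> 1" for i
        using indep[OF N] by (rule indep_vars_measurable) (use that in simp)
      have [measurable]: "(\<lambda>\<omega>. mat_opnorm (X N 1 \<omega>)) \<in> borel_measurable (M N)"
        "(\<lambda>\<omega>. mat_opnorm (mat_prod N (X N) (Suc n0) \<omega>)) \<in> borel_measurable (M N)"
        by (auto simp del: mat_prod.simps intro!: measurable_mat_opnorm measurable_mat_prod X)
      let ?e = "expectation (\<lambda>\<omega>. ln (vnorm (X N 1 \<omega> *\<^sub>v v N)))"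
      have p: "\<P>(\<omega> in M N. vnorm (X N i \<omega> *\<^sub>v u) \<le> exp (- L)) \<le> C / L\<^sup>2"
        if "i \<ge> 1" "u \<in> unit_sphere N" for i u
        using C[OF N that] that L1
        by (intro prob_le_exp_minus measurable_vnorm_mult[OF X] vnorm_nonneg) (auto simp: unit_sphere_def)
      have e: "?e \<le> 1 + C"
        using C[OF N order_refl v[OF N]] by (intro expectation_le_square_bound) auto
      let ?Z = "\<lambda>\<omega>. mat_opnorm (mat_prod N (X N) (Suc n0) \<omega>)"
      have neg: "\<P>(\<omega> in M N. \<not> ?Z \<omega> \<le> T) = 1 - \<P>(\<omega> in M N. ?Z \<omega> \<le> T)"
        "\<P>(\<omega> in M N. \<not> mat_opnorm (X N 1 \<omega>) \<le> c) = 1 - \<P>(\<omega> in M N. mat_opnorm (X N 1 \<omega>) \<le> c)"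
        by (rule prob_neg, measurable)+
      have "\<P>(\<omega> in M N. \<not> ?Z \<omega> \<le> T) \<le>
          \<P>(\<omega> in M N. \<bar>ln (?Z \<omega>) / real (Suc n0) - ?e\<bar> \<ge> \<delta>)"
      proof (rule finite_measure_mono)
        show "{\<omega> \<in> space (M N). \<not> ?Z \<omega> \<le> T} \<subseteq> {\<omega> \<in> space (M N). \<delta> \<le> \<bar>ln (?Z \<omega>) / real (Suc n0) - ?e\<bar>}"
        proof clarify
          fix \<omega>
          assume "\<not> ?Z \<omega> \<le> T"
          \<comment> \<open>Both logarithms are taken at positive arguments, so the convention for
            \<open>ln 0\<close> does not interfere.\<close>
          moreover have "0 < T"
            by (simp add: T_def)
          ultimately have "ln T < ln (?Z \<omega>)"
            by (subst ln_less_cancel_iff) linarith+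
          then have "1 + C + \<delta> < ln (?Z \<omega>) / real (Suc n0)"
            unfolding T_def ln_exp by (simp add: pos_less_divide_eq mult.commute del: mat_prod.simps)
          then show "\<delta> \<le> \<bar>ln (?Z \<omega>) / real (Suc n0) - ?e\<bar>"
            using e by linarith
        qed
      qed measurable
      also have "\<dots> \<le> \<delta>"
        by (rule n0[OF N]) simp
      finally have "1 - \<delta> \<le> \<P>(\<omega> in M N. ?Z \<omega> \<le> T)"
        unfolding neg by linarith
      \<comment> \<open>The iterated estimate read backwards: the product of \<open>Suc n0\<close>
        factors is at most \<open>T\<close> with probability at least \<open>1 - \<delta>\<close>,
        so \<open>X N 1\<close> has norm at most \<open>c\<close> with probability at least
        \<open>1 - 2 * \<delta>\<close>.\<close>
      also have "\<dots> \<le> \<P>(\<omega> in M N. mat_opnorm (X N 1 \<omega>) \<le> c) + n0 * (C / L\<^sup>2)"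
        using prob_opnorm_mat_prod_le[OF indep[OF N] p _ _ c, of n0] C0 unfolding Tc by simp
      finally have "\<P>(\<omega> in M N. \<not> mat_opnorm (X N 1 \<omega>) \<le> c) \<le> 2 * \<delta>"
        using L unfolding neg by linarith
      moreover have "\<P>(\<omega> in M N. mat_opnorm (X N 1 \<omega>) \<ge> b N) \<le>
          \<P>(\<omega> in M N. \<not> mat_opnorm (X N 1 \<omega>) \<le> c)"
        by (intro finite_measure_mono) (use elim in force, measurable)
      ultimately show ?case
        using \<epsilon> by (simp add: \<delta>_def)
    qed
  qed
  show ?thesis
    by (rule tendstoI) (use small in \<open>simp add: dist_real_def\<close>)
qed

end
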